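(* Let $P(\cdot)$ be a nondecreasing nonnegative function on the positive integers, let $T\ge1$, let $f_1,\dots,f_T:\mathcal K\to\mathbb R$ be convex, and let $x_1^*,\dots,x_T^*\in\mathcal K$ be a comparator sequence with $P(t)\ge\sum_{\tau=1}^{t-1}\|x_{\tau+1}^*-x_\tau^*\|$ for all $1\le t\le T$. Put $t_0=0$ and, for $k\ge1$, let $t_k$ be the largest $t$ with $P(t)\le D(2^{k-1}-1)$ (with $t_k=0$ if there is none). Suppose projected subgradient descent is reset following rounds $t_{k-1}$, the $k$-th run lasting until (including) round $t_k$ (or until the end $T$ if $t_k\geq T$; a run with $t_k=t_{k-1}$ is skipped), and for $t_{k-1}<t\le t_k$ uses the step sizes $$\eta_t=D\,\sqrt{P_k/D+1/2}\,\Bigl(\sum_{\tau=t_{k-1}+1}^{t}\|g_\tau\|^2\Bigr)^{-1/2},\qquad P_k=D(2^{k-1}-1).$$ Then the decisions $x_1,\dots,x_T$ satisfy $$\sum_{t=1}^T\bigl(f_t(x_t)-f_t(x_t^* )\bigr)\le 4D\sqrt{\frac{P(T)}{D}+\frac{6-K}{8}}\;\sqrt{\sum_{t=1}^T\|g_t\|^2},$$ where $K=\min\{x\in\mathbb Z:\ P(T)\le D(2^{x-1}-1)\}$. This guarantee is minimax optimal within a constant factor: there is an absolute constant $c$ such that the right-hand side is at most $c\cdot\frac{D G_T}{2\sqrt2}\sqrt{\lfloor P(T)/D\rfloor+1}$ with $G_T=\sqrt{\sum_{t=1}^T\|g_t\|^2}$.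
   Context: $\mathcal K\subset\mathbb R^N$ is a nonempty convex, closed and bounded set with diameter $D=\sup_{x,v\in\mathcal K}\|x-v\|>0$; $\|\cdot\|$ is the Euclidean norm and $\mathrm{Proj}_{\mathcal K}(x)=\arg\min_{v\in\mathcal K}\|x-v\|^2$. For convex $f:\mathcal K\to\mathbb R$, $\partial f(x)$ is the set of $g\in\mathbb R^N$ with $f(x)-f(v)\le g^\top(x-v)$ for all $v\in\mathcal K$. Online projected subgradient descent with step sizes $\eta_t$: at each round $t$ of a run, with current decision $x_t\in\mathcal K$, receive a subgradient $g_t\in\partial f_t(x_t)$; if $g_t=0$ set $x_{t+1}=x_t$, otherwise set $x_{t+1}=\mathrm{Proj}_{\mathcal K}(x_t-\eta_t g_t)$. No step size is needed while all subgradients of the run so far are zero. Resetting following round $s$ means that a new run starts at round $s+1$ from an arbitrary point of $\mathcal K$, with the accumulated sum of squared subgradient norms restarted from zero. "Minimax optimal within a constant factor" refers to comparison with the worst-case dynamic regret lower bound $\frac{D G_T}{2\sqrt2}\sqrt{\lfloor P/D\rfloor+1}$, valid for every causal algorithm against comparators of path variation at most $P$, taken at $P=P(T)$. *)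

theory Defs
  imports "HOL-Analysis.Analysis" "HOL-Library.Extended_Nat"
begin

definition subdifferential_on :: "'a::real_inner set \<Rightarrow> ('a \<Rightarrow> real) \<Rightarrow> 'a \<Rightarrow> 'a set" where
  "subdifferential_on C f x = {g. \<forall>v\<in>C. f x - f v \<le> g \<bullet> (x - v)}"

(* The index is an integer because the constant K of the regret bound is a minimum over all of int. *)
definition variation_budget :: "real \<Rightarrow> int \<Rightarrow> real" where
  "variation_budget D k = D * (2 powi (k - 1) - 1)"

(* The supremum in enat is the largest element of the set if the set is finite and nonempty, 0 if it
   is empty, and infinity if P never exceeds the budget (the k-th run then lasts until the end). *)
definition run_end :: "real \<Rightarrow> (nat \<Rightarrow> real) \<Rightarrow> nat \<Rightarrow> enat" where
  "run_end D P k =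
     (if k = 0 then 0 else Sup (enat ` {t. 1 \<le> t \<and> P t \<le> variation_budget D (int k)}))"

definition step_size :: "real \<Rightarrow> (nat \<Rightarrow> real) \<Rightarrow> (nat \<Rightarrow> 'a::real_normed_vector) \<Rightarrow> nat \<Rightarrow> nat \<Rightarrow> real" where
  "step_size D P g k t =
     D * sqrt (variation_budget D (int k) / D + 1/2) /
     sqrt (\<Sum>\<tau> | run_end D P (k - 1) < enat \<tau> \<and> \<tau> \<le> t. (norm (g \<tau>))\<^sup>2)"

(* Run k >= 1 consists of the rounds t with run_end (k-1) < t <= run_end k. The update is only imposed
   when rounds t and t+1 lie in the same run, so the first decision of each run is an arbitrary point
   of C. The function closest_point C is the projection onto C. *)
definition resetting_subgradient_descent ::
  "'a::euclidean_space set \<Rightarrow> (nat \<Rightarrow> real) \<Rightarrow> nat \<Rightarrow> (nat \<Rightarrow> 'a \<Rightarrow> real) \<Rightarrow>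
   (nat \<Rightarrow> 'a) \<Rightarrow> (nat \<Rightarrow> 'a) \<Rightarrow> bool" where
  "resetting_subgradient_descent C P T f x g \<longleftrightarrow>
     (\<forall>t\<in>{1..T}. x t \<in> C \<and> g t \<in> subdifferential_on C (f t) (x t)) \<and>
     (\<forall>k\<ge>1. \<forall>t\<in>{1..<T}.
        run_end (diameter C) P (k - 1) < enat t \<and> enat (t + 1) \<le> run_end (diameter C) P k \<longrightarrow>
        x (t + 1) =
          (if g t = 0 then x t
           else closest_point C (x t - step_size (diameter C) P g k t *\<^sub>R g t)))"

(* Arguments: diameter D, path variation p = P(T), and G, the root of the sum of the squared
   subgradient norms. *)
definition regret_bound :: "real \<Rightarrow> real \<Rightarrow> real \<Rightarrow> real" where
  "regret_bound D p G =
     (let K = (LEAST k::int. p \<le> variation_budget D k)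
      in 4 * D * sqrt (p / D + (6 - real_of_int K) / 8) * G)"

definition minimax_lower_bound :: "real \<Rightarrow> real \<Rightarrow> real \<Rightarrow> real" where
  "minimax_lower_bound D p G = D * G / (2 * sqrt 2) * sqrt (real_of_int \<lfloor>p / D\<rfloor> + 1)"

end

theory Submission
  imports Defs
begin

text \<open>Within the \<open>k\<close>-th run, a potential argument bounds the regret by
  \<open>(D\<^sup>2/2 + D V)/\<alpha> + \<alpha>\<close> times the root of the run's gradient sum, where \<open>V\<close> is the path variation
  inside the run and \<open>\<alpha> = D \<surd>(P\<^sub>k/D + 1/2)\<close>. As \<open>V \<le> P\<^sub>k\<close>, this is at most \<open>2 \<alpha>\<close> times that root.
  The last run is the \<open>K\<close>-th, so the Cauchy-Schwarz inequality over the runs leaves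
  \<open>\<Sum>k\<le>K. (P\<^sub>k/D + 1/2) = 2\<^sup>K - 1 - K/2\<close>, and minimality of \<open>K\<close> gives \<open>2\<^sup>K < 4 (P(T)/D + 1)\<close>.\<close>

section \<open>Regret of a single run against a moving comparator\<close>

lemma norm_diff_power2_scaleR:
  fixes y h :: "'a::real_inner"
  shows "(norm (y - s *\<^sub>R h))\<^sup>2 = (norm y)\<^sup>2 - 2 * s * (h \<bullet> y) + s\<^sup>2 * (norm h)\<^sup>2"
  unfolding power2_norm_eq_inner
  by (simp add: inner_diff_left inner_diff_right inner_commute power2_eq_square algebra_simps)

text \<open>The projection is non-expansive and fixes \<open>v\<close>; expanding the square of the
  unprojected distance gives the rest. Here \<open>w\<close> is the reciprocal of twice the step
  size, the form in which it enters the potential later.\<close>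

lemma projection_step_bound:
  fixes C :: "'a::euclidean_space set"
  assumes "convex C" "closed C" "v \<in> C" and w: "w > 0"
  shows "h \<bullet> (y - v) \<le> w * ((norm (y - v))\<^sup>2
           - (norm (closest_point C (y - (1 / (2 * w)) *\<^sub>R h) - v))\<^sup>2) + (norm h)\<^sup>2 / (4 * w)"
proof -
  let ?z = "y - (1 / (2 * w)) *\<^sub>R h"
  have "dist (closest_point C ?z) (closest_point C v) \<le> dist ?z v"
    using assms by (intro closest_point_lipschitz) auto
  then have "norm (closest_point C ?z - v) \<le> norm (?z - v)"
    using \<open>v \<in> C\<close> by (simp add: closest_point_self dist_norm)
  then have "(norm (closest_point C ?z - v))\<^sup>2 \<le> (norm (?z - v))\<^sup>2"
    by (intro power_mono) auto
  also have "\<dots> = (norm (y - v - (1 / (2 * w)) *\<^sub>R h))\<^sup>2"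
    by (simp add: algebra_simps)
  also have "\<dots> = (norm (y - v))\<^sup>2 - h \<bullet> (y - v) / w + (norm h)\<^sup>2 / (4 * w\<^sup>2)"
    using w unfolding norm_diff_power2_scaleR by (simp add: field_simps power2_eq_square)
  finally have "w * (norm (closest_point C ?z - v))\<^sup>2
      \<le> w * ((norm (y - v))\<^sup>2 - h \<bullet> (y - v) / w + (norm h)\<^sup>2 / (4 * w\<^sup>2))"
    using w by (intro mult_left_mono) auto
  also have "\<dots> = w * (norm (y - v))\<^sup>2 - h \<bullet> (y - v) + (norm h)\<^sup>2 / (4 * w)"
    using w by (simp add: field_simps power2_eq_square)
  finally show ?thesis
    by (simp add: algebra_simps)
qed

text \<open>After clearing the denominator this is the nonnegativity of the square of
  \<open>sqrt (s + r) - sqrt s\<close>. It makes the squared gradient norms, divided by the root of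
  their running sum, telescope.\<close>

lemma half_quotient_le_sqrt_diff:
  fixes s r :: real
  assumes "s \<ge> 0" "r \<ge> 0" "s + r > 0"
  shows "r / (2 * sqrt (s + r)) \<le> sqrt (s + r) - sqrt s"
proof -
  have "r \<le> 2 * sqrt (s + r) * (sqrt (s + r) - sqrt s)"
    using assms zero_le_power2[of "sqrt (s + r) - sqrt s"]
    by (simp add: power2_diff algebra_simps)
  then show ?thesis
    using assms by (simp add: field_simps)
qed

text \<open>Price of a comparator move: the difference of squares factors, one factor being at most
  the length of the move and the other at most \<open>2 * D\<close>.\<close>

lemma norm_diff_power2_shift:
  fixes y v v' :: "'a::real_inner"
  assumes "norm (y - v) \<le> D" "norm (y - v') \<le> D"
  shows "(norm (y - v'))\<^sup>2 \<le> (norm (y - v))\<^sup>2 + 2 * D * norm (v' - v)"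
proof -
  have "norm (y - v') \<le> norm (y - v) + norm (v' - v)"
    using norm_triangle_ineq4[of "y - v" "v' - v"] by simp
  then have "(norm (y - v') - norm (y - v)) * (norm (y - v') + norm (y - v))
      \<le> norm (v' - v) * (norm (y - v') + norm (y - v))"
    by (intro mult_right_mono) auto
  also have "\<dots> \<le> norm (v' - v) * (2 * D)"
    using assms by (intro mult_left_mono) auto
  finally show ?thesis
    by (simp add: power2_eq_square algebra_simps)
qed

text \<open>An invariant bounds the linearised regret by
  \<open>W n * (D^2 + 2 * D * V n - dist^2) + \<alpha> * sqrt (S n)\<close>, with
  \<open>dist\<close> the distance from decision to comparator. The growth of \<open>V\<close> pays
  for comparator moves, that of \<open>sqrt (S n)\<close> for the gradient terms. The update stops
  before \<open>b\<close> because the decision after a run is free.\<close>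

lemma run_regret_bound:
  fixes C :: "'a::euclidean_space set" and x u g :: "nat \<Rightarrow> 'a"
  assumes C: "convex C" "closed C"
    and D: "\<And>y v. y \<in> C \<Longrightarrow> v \<in> C \<Longrightarrow> norm (y - v) \<le> D"
    and \<alpha>: "\<alpha> > 0" and ab: "a \<le> b"
    and x: "\<And>t. t \<in> {a..b} \<Longrightarrow> x t \<in> C" and u: "\<And>t. t \<in> {a..b} \<Longrightarrow> u t \<in> C"
    and upd: "\<And>t. t \<in> {a..<b} \<Longrightarrow> x (t + 1) = (if g t = 0 then x t
        else closest_point C (x t - (\<alpha> / sqrt (\<Sum>\<tau>\<in>{a..t}. (norm (g \<tau>))\<^sup>2)) *\<^sub>R g t))"
  shows "(\<Sum>t\<in>{a..b}. g t \<bullet> (x t - u t))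
     \<le> ((D\<^sup>2 / 2 + D * (\<Sum>\<tau>\<in>{a..<b}. norm (u (\<tau> + 1) - u \<tau>))) / \<alpha> + \<alpha>)
         * sqrt (\<Sum>t\<in>{a..b}. (norm (g t))\<^sup>2)"
proof -
  define S where "S n = (\<Sum>\<tau>\<in>{a..<n}. (norm (g \<tau>))\<^sup>2)" for n
  define V where "V n = (\<Sum>\<tau>\<in>{a..<n}. norm (u (\<tau> + 1) - u \<tau>))" for n
  define L where "L n = (\<Sum>t\<in>{a..<n}. g t \<bullet> (x t - u t))" for n
  define W where "W n = sqrt (S n) / (2 * \<alpha>)" for n
  \<comment> \<open>Inside the run this is the next decision; at \<open>b\<close> it is a virtual
    one, so the last round can be treated like the others.\<close>
  define y where "y t = (if g t = 0 then x t
      else closest_point C (x t - (\<alpha> / sqrt (S (Suc t))) *\<^sub>R g t))" for t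
  have S0: "S n \<ge> 0" and V0: "V n \<ge> 0" for n
    by (auto simp: S_def V_def intro!: sum_nonneg)
  have W0: "W n \<ge> 0" for n
    using \<alpha> S0[of n] by (simp add: W_def)
  have D0: "D \<ge> 0"
    using D[of "x a" "x a"] x[of a] ab by simp
  \<comment> \<open>The comparator is still \<open>u n\<close> here. Its move is charged only in the
    induction below, so the final bound involves \<open>V b\<close> and no comparator beyond round
    \<open>b\<close>.\<close>
  have potential_step: "L (Suc n) \<le> W (Suc n) * (D\<^sup>2 + 2 * D * V n - (norm (y n - u n))\<^sup>2)
      + \<alpha> * sqrt (S (Suc n))"
    if n: "a \<le> n" "n \<le> b" and
      IH: "L n \<le> W n * (D\<^sup>2 + 2 * D * V n - (norm (x n - u n))\<^sup>2) + \<alpha> * sqrt (S n)" for n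
  proof -
    have SS: "S (Suc n) = S n + (norm (g n))\<^sup>2" and LL: "L (Suc n) = L n + g n \<bullet> (x n - u n)"
      using n by (auto simp: S_def L_def)
    have 1: "g n \<bullet> (x n - u n) \<le> W (Suc n) * ((norm (x n - u n))\<^sup>2 - (norm (y n - u n))\<^sup>2)
        + \<alpha> * (sqrt (S (Suc n)) - sqrt (S n))"
    \<comment> \<open>A zero gradient changes neither the decision nor \<open>S\<close>; this case
      also absorbs a vanishing gradient sum, so the step size is never divided by zero.\<close>
    proof (cases "g n = 0")
      case True
      then show ?thesis by (simp add: y_def SS)
    next
      case False
      then have pos: "S (Suc n) > 0"
        using S0[of n] by (simp add: SS add_nonneg_pos)
      then have Wp: "W (Suc n) > 0"
        using \<alpha> by (simp add: W_def)
      have e: "1 / (2 * W (Suc n)) = \<alpha> / sqrt (S (Suc n))"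
        by (simp add: W_def)
      have "(norm (g n))\<^sup>2 / (4 * W (Suc n)) = \<alpha> * ((norm (g n))\<^sup>2 / (2 * sqrt (S (Suc n))))"
        by (simp add: W_def)
      also have "\<dots> \<le> \<alpha> * (sqrt (S (Suc n)) - sqrt (S n))"
        using half_quotient_le_sqrt_diff[of "S n" "(norm (g n))\<^sup>2"] S0[of n] pos \<alpha>
        by (intro mult_left_mono) (auto simp: SS)
      finally show ?thesis
        using projection_step_bound[OF C u[of n] Wp, of "g n" "x n"] n False
        by (simp add: e y_def)
    qed
    \<comment> \<open>The weight in the invariant may be raised to that of the current step because
      the bracket is nonnegative: the distance is at most \<open>D\<close>.\<close>
    have "W n \<le> W (Suc n)"
      using \<alpha> by (simp add: W_def SS divide_right_mono)
    moreover have "D\<^sup>2 + 2 * D * V n - (norm (x n - u n))\<^sup>2 \<ge> 0"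
      using power_mono[OF D[OF x u] norm_ge_zero, of n n 2] n D0 V0[of n]
      by (simp add: add_increasing2)
    ultimately have "W n * (D\<^sup>2 + 2 * D * V n - (norm (x n - u n))\<^sup>2)
        \<le> W (Suc n) * (D\<^sup>2 + 2 * D * V n - (norm (x n - u n))\<^sup>2)"
      by (rule mult_right_mono)
    then show ?thesis
      using 1 IH by (simp add: LL algebra_simps)
  qed
  have inv: "L n \<le> W n * (D\<^sup>2 + 2 * D * V n - (norm (x n - u n))\<^sup>2) + \<alpha> * sqrt (S n)"
    if "a \<le> n" "n \<le> b" for n
    using that
  proof (induction n rule: dec_induct)
    case base
    then show ?case by (simp add: L_def W_def S_def)
  next
    case (step n)
    have y: "y n = x (Suc n)"
      using upd[of n] step by (simp add: y_def S_def atLeastLessThanSuc_atLeastAtMost)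
    have VV: "V (Suc n) = V n + norm (u (Suc n) - u n)"
      using step by (simp add: V_def)
    have "(norm (x (Suc n) - u (Suc n)))\<^sup>2
        \<le> (norm (x (Suc n) - u n))\<^sup>2 + 2 * D * norm (u (Suc n) - u n)"
      using step by (intro norm_diff_power2_shift D x u) auto
    then have "W (Suc n) * (D\<^sup>2 + 2 * D * V n - (norm (y n - u n))\<^sup>2)
        \<le> W (Suc n) * (D\<^sup>2 + 2 * D * V (Suc n) - (norm (x (Suc n) - u (Suc n)))\<^sup>2)"
      by (intro mult_left_mono W0) (simp add: y VV algebra_simps)
    then show ?case
      using potential_step[of n] step by simp
  qed
  have "L (Suc b) \<le> W (Suc b) * (D\<^sup>2 + 2 * D * V b - (norm (y b - u b))\<^sup>2)
      + \<alpha> * sqrt (S (Suc b))"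
    using potential_step inv ab by simp
  also have "\<dots> \<le> W (Suc b) * (D\<^sup>2 + 2 * D * V b) + \<alpha> * sqrt (S (Suc b))"
    using W0 by (intro add_right_mono mult_left_mono) auto
  also have "\<dots> = ((D\<^sup>2 / 2 + D * V b) / \<alpha> + \<alpha>) * sqrt (S (Suc b))"
    using \<alpha> by (simp add: W_def field_simps)
  finally show ?thesis
    by (simp add: L_def S_def V_def atLeastLessThanSuc_atLeastAtMost)
qed

section \<open>Doubling budgets and the boundaries of the runs\<close>

lemma variation_budget_mono:
  assumes "D > 0" "i \<le> j"
  shows "variation_budget D i \<le> variation_budget D j"
  using assms by (simp add: variation_budget_def power_int_increasing)

lemma variation_budget_0_neg: "D > 0 \<Longrightarrow> variation_budget D 0 < 0"
  by (simp add: variation_budget_def power_int_minus)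

lemma variation_budget_Suc: "variation_budget D (int (Suc j)) = D * (2 ^ j - 1)"
  by (simp add: variation_budget_def)

text \<open>The lower bound holds for \<open>k = 1\<close> too, because the budget of index \<open>0\<close> is negative.\<close>

lemma ex_budget_index:
  assumes D: "D > 0" and p: "p \<ge> 0"
  obtains k :: nat where "k \<ge> 1" "variation_budget D (int k - 1) < p" "p \<le> variation_budget D (int k)"
    "(LEAST j. p \<le> variation_budget D j) = int k"
proof -
  obtain n :: nat where "p / D + 1 < 2 ^ n"
    using real_arch_pow[of 2 "p / D + 1"] by auto
  then have "p \<le> variation_budget D (int (Suc n))"
    using D unfolding variation_budget_Suc by (simp add: field_simps)
  then have ex: "\<exists>n::nat. p \<le> variation_budget D (int n)" ..
  define k where "k = (LEAST n::nat. p \<le> variation_budget D (int n))"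
  have le: "p \<le> variation_budget D (int k)"
    unfolding k_def using ex by (rule LeastI_ex)
  have k1: "k \<ge> 1"
    using le variation_budget_0_neg[OF D] p by (cases k) auto
  have "\<not> p \<le> variation_budget D (int (k - 1))"
    using k1 unfolding k_def by (intro not_less_Least) (auto simp: k_def[symmetric])
  then have lt: "variation_budget D (int k - 1) < p"
    using k1 by (simp add: of_nat_diff)
  have "(LEAST j. p \<le> variation_budget D j) = int k"
  proof (rule Least_equality)
    show "p \<le> variation_budget D (int k)" by (fact le)
    \<comment> \<open>The search ran over naturals only; monotonicity of the budget excludes all
      smaller integers, negative ones included.\<close>
    show "int k \<le> j" if "p \<le> variation_budget D j" for j
      using that lt variation_budget_mono[OF D, of j "int k - 1"] by linarith
  qed
  then show thesis using that k1 lt le by blast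
qed

text \<open>Monotonicity of \<open>P\<close> makes the rounds within a budget an initial segment, so
  its supremum decides membership. For \<open>k = 0\<close> both sides are false, the budget being
  negative.\<close>

lemma enat_le_run_end_iff:
  assumes P: "mono_on {1..} P" "P t \<ge> 0" and D: "D > 0" and t: "t \<ge> 1"
  shows "enat t \<le> run_end D P k \<longleftrightarrow> P t \<le> variation_budget D (int k)"
proof (cases "k = 0")
  case True
  then show ?thesis
    using variation_budget_0_neg[OF D] P t by (simp add: run_end_def zero_enat_def)
next
  case False
  let ?A = "{t. 1 \<le> t \<and> P t \<le> variation_budget D (int k)}"
  show ?thesis
  proof
    assume "P t \<le> variation_budget D (int k)"
    then show "enat t \<le> run_end D P k"
      using False t by (auto simp: run_end_def intro!: Sup_upper)
  next
    assume le: "enat t \<le> run_end D P k"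
    \<comment> \<open>Otherwise \<open>t - 1\<close> would bound the set; this argument handles
      empty, finite and infinite sets alike.\<close>
    have "\<exists>s\<in>?A. t \<le> s"
    proof (rule ccontr)
      assume "\<not> ?thesis"
      then have "Sup (enat ` ?A) \<le> enat (t - 1)"
        by (intro Sup_least) force
      then have "enat t \<le> enat (t - 1)"
        using le False unfolding run_end_def by (simp only: if_False)
      then show False using t by simp
    qed
    then obtain s where "s \<in> ?A" "t \<le> s" by blast
    then show "P t \<le> variation_budget D (int k)"
      using mono_onD[OF P(1), of t s] t by auto
  qed
qed

section \<open>Comparison with the lower bound\<close>

lemma regret_bound_le_minimax:
  assumes D: "D > 0" and p: "p \<ge> 0" and G: "G \<ge> 0"
  shows "regret_bound D p G \<le> 16 * minimax_lower_bound D p G"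
proof -
  obtain k :: nat where k: "k \<ge> 1" "(LEAST j. p \<le> variation_budget D j) = int k"
    using ex_budget_index[OF D p] by metis
  let ?m = "real_of_int \<lfloor>p / D\<rfloor> + 1"
  have "p / D < ?m" "?m \<ge> 1" "real k \<ge> 1"
    using D p k(1) by (linarith, simp_all)
  \<comment> \<open>Both summands are at most \<open>?m\<close>, the second being at most 5/8. The
    constant 16 is then 4 times \<open>sqrt 2\<close> times \<open>2 * sqrt 2\<close>.\<close>
  then have "p / D + (6 - real k) / 8 \<le> 2 * ?m"
    by argo
  then have "sqrt (p / D + (6 - real k) / 8) \<le> sqrt 2 * sqrt ?m"
    by (metis real_sqrt_le_mono real_sqrt_mult)
  then have "4 * D * sqrt (p / D + (6 - real k) / 8) * G \<le> 4 * D * (sqrt 2 * sqrt ?m) * G"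
    using D G by (intro mult_right_mono mult_left_mono) auto
  also have "\<dots> = 16 * minimax_lower_bound D p G"
    by (simp add: minimax_lower_bound_def field_simps)
  finally show ?thesis
    by (simp add: regret_bound_def k)
qed

section \<open>Summation over the runs\<close>

lemma sum_run_constants: "(\<Sum>k\<in>{1..K}. 2 ^ (k - 1) - 1 / 2) = 2 ^ K - 1 - real K / 2"
  by (induction K) (auto simp: field_simps)

theorem theorem4:
  fixes C :: "(real ^ 'n) set"
    and P :: "nat \<Rightarrow> real"
    and T :: nat
    and f :: "nat \<Rightarrow> real ^ 'n \<Rightarrow> real"
    and x g u :: "nat \<Rightarrow> real ^ 'n"
  assumes "C \<noteq> {}" and "convex C" and "closed C" and "bounded C" and "diameter C > 0"
    and "mono_on {1..} P" and "\<And>t. t \<ge> 1 \<Longrightarrow> P t \<ge> 0"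
    and "T \<ge> 1"
    and "\<And>t. t \<in> {1..T} \<Longrightarrow> convex_on C (f t)"
    and "\<And>t. t \<in> {1..T} \<Longrightarrow> u t \<in> C"
    and "\<And>t. t \<in> {1..T} \<Longrightarrow> P t \<ge> (\<Sum>\<tau>\<in>{1..<t}. norm (u (\<tau> + 1) - u \<tau>))"
    and "resetting_subgradient_descent C P T f x g"
  shows "(\<Sum>t\<in>{1..T}. f t (x t) - f t (u t))
           \<le> regret_bound (diameter C) (P T) (sqrt (\<Sum>t\<in>{1..T}. (norm (g t))\<^sup>2))
       \<and> (\<exists>c::real. \<forall>D p G. D > 0 \<and> p \<ge> 0 \<and> G \<ge> 0 \<longrightarrow>
             regret_bound D p G \<le> c * minimax_lower_bound D p G)"
proof -
  let ?D = "diameter C" and ?vb = "variation_budget (diameter C)"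
  have D: "?D > 0" by fact
  have diam: "norm (y - v) \<le> ?D" if "y \<in> C" "v \<in> C" for y v
    using diameter_bounded_bound[OF \<open>bounded C\<close> that] by (simp add: dist_norm)
  have mono: "P s \<le> P t" if "1 \<le> s" "s \<le> t" for s t
    using mono_onD[OF assms(6), of s t] that by simp
  have run_end: "enat t \<le> run_end ?D P k \<longleftrightarrow> P t \<le> ?vb (int k)" if "t \<ge> 1" for t k
    using enat_le_run_end_iff[OF assms(6) assms(7)[OF that] D that] .
  have x: "x t \<in> C" and g: "g t \<in> subdifferential_on C (f t) (x t)" if "t \<in> {1..T}" for t
    using assms(12) that by (auto simp: resetting_subgradient_descent_def)
  \<comment> \<open>The runs are described by budgets instead of \<open>run_end\<close>, which makes
    them visibly disjoint intervals. For \<open>k = 1\<close> the lower condition is void, since the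
    budget of index 0 is negative.\<close>
  define R where "R k = {t \<in> {1..T}. ?vb (int k - 1) < P t \<and> P t \<le> ?vb (int k)}" for k
  define Q where "Q k = (\<Sum>t\<in>R k. (norm (g t))\<^sup>2)" for k
  have run: "(\<Sum>t\<in>R k. f t (x t) - f t (u t)) \<le> 2 * ?D * (sqrt (2 ^ (k - 1) - 1 / 2) * sqrt (Q k))"
    if k: "k \<ge> 1" for k
  proof (cases "R k = {}")
    case True
    then show ?thesis by (simp add: Q_def)
  next
    case False
    define a where "a = Min (R k)"
    define b where "b = Max (R k)"
    define V where "V = (\<Sum>\<tau>\<in>{a..<b}. norm (u (\<tau> + 1) - u \<tau>))"
    define c :: real where "c = 2 ^ (k - 1) - 1 / 2"
    have fin: "finite (R k)" by (simp add: R_def)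
    have aR: "a \<in> R k" and bR: "b \<in> R k"
      using False fin by (auto simp: a_def b_def)
    have ab: "a \<le> b"
      using aR fin by (simp add: b_def)
    have R: "R k = {a..b}"
    proof
      show "R k \<subseteq> {a..b}"
        using fin by (auto simp: a_def b_def)
      show "{a..b} \<subseteq> R k"
      proof
        fix t assume "t \<in> {a..b}"
        then show "t \<in> R k"
          using mono[of a t] mono[of t b] aR bR by (auto simp: R_def)
      qed
    qed
    have sub: "{a..b} \<subseteq> {1..T}"
      unfolding R[symmetric] by (auto simp: R_def)
    have vbk: "?vb (int k) / ?D + 1 / 2 = c"
      using variation_budget_Suc[of ?D "k - 1"] k D by (simp add: c_def)
    have "(1::real) \<le> 2 ^ (k - 1)" by simp
    then have c: "c > 0" unfolding c_def by linarith
    have past: "run_end ?D P (k - 1) < enat t \<longleftrightarrow> ?vb (int k - 1) < P t" if "t \<ge> 1" for t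
      using run_end[OF that, of "k - 1"] k by (simp add: of_nat_diff not_le[symmetric])
    have upd: "x (t + 1) = (if g t = 0 then x t
        else closest_point C (x t - (?D * sqrt c / sqrt (\<Sum>\<tau>\<in>{a..t}. (norm (g \<tau>))\<^sup>2)) *\<^sub>R g t))"
      if t: "t \<in> {a..<b}" for t
    proof -
      have tR: "t \<in> R k" "t + 1 \<in> R k"
        using t by (auto simp: R)
      \<comment> \<open>The left side ranges over all naturals; round 0 drops out because
        \<open>enat 0\<close> exceeds no run end.\<close>
      have "{\<tau>. run_end ?D P (k - 1) < enat \<tau> \<and> \<tau> \<le> t} = {a..t}"
      proof (intro equalityI subsetI)
        fix \<tau> assume \<tau>: "\<tau> \<in> {\<tau>. run_end ?D P (k - 1) < enat \<tau> \<and> \<tau> \<le> t}"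
        then have "\<tau> \<ge> 1"
          by (cases \<tau>) (auto simp flip: zero_enat_def)
        then have "\<tau> \<in> R k"
          using \<tau> past[of \<tau>] mono[of \<tau> t] tR(1) by (auto simp: R_def)
        then show "\<tau> \<in> {a..t}"
          using \<tau> by (auto simp: R)
      next
        fix \<tau> assume "\<tau> \<in> {a..t}"
        then have "\<tau> \<in> R k" "\<tau> \<le> t"
          using t by (auto simp: R)
        then show "\<tau> \<in> {\<tau>. run_end ?D P (k - 1) < enat \<tau> \<and> \<tau> \<le> t}"
          using past[of \<tau>] by (auto simp: R_def)
      qed
      then have "step_size ?D P g k t = ?D * sqrt c / sqrt (\<Sum>\<tau>\<in>{a..t}. (norm (g \<tau>))\<^sup>2)"
        by (simp add: step_size_def vbk)
      moreover have "t \<in> {1..<T}" "run_end ?D P (k - 1) < enat t" "enat (t + 1) \<le> run_end ?D P k"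
        using tR past[of t] run_end[of "t + 1" k] by (auto simp: R_def)
      ultimately show ?thesis
        using assms(12) k unfolding resetting_subgradient_descent_def by metis
    qed
    \<comment> \<open>The hypothesis on \<open>P\<close> controls only the variation since round 1,
      so the variation inside the run is enlarged to that.\<close>
    have "V \<le> (\<Sum>\<tau>\<in>{1..<b}. norm (u (\<tau> + 1) - u \<tau>))"
      unfolding V_def using sub ab by (intro sum_mono2) auto
    also have "\<dots> \<le> P b"
      using assms(11)[of b] sub ab by auto
    also have "\<dots> \<le> ?D * (c - 1 / 2)"
      using bR D vbk by (auto simp: R_def field_simps)
    finally have "?D\<^sup>2 / 2 + ?D * V \<le> ?D\<^sup>2 / 2 + ?D * (?D * (c - 1 / 2))"
      using D by (intro add_left_mono mult_left_mono) auto
    \<comment> \<open>The summand 1/2 in the step size is chosen for this: it absorbs the initial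
      distance term, and both parts of the coefficient become at most
      \<open>?D * sqrt c\<close>.\<close>
    also have "\<dots> = ?D\<^sup>2 * c"
      by (simp add: algebra_simps power2_eq_square)
    finally have "(?D\<^sup>2 / 2 + ?D * V) / (?D * sqrt c) \<le> ?D\<^sup>2 * c / (?D * sqrt c)"
      using D c by (intro divide_right_mono) auto
    also have "\<dots> = ?D * sqrt c"
      using D c by (simp add: field_simps power2_eq_square)
    finally have coeff: "(?D\<^sup>2 / 2 + ?D * V) / (?D * sqrt c) + ?D * sqrt c \<le> 2 * ?D * sqrt c"
      by simp
    have "(\<Sum>t\<in>R k. f t (x t) - f t (u t)) \<le> (\<Sum>t\<in>{a..b}. g t \<bullet> (x t - u t))"
      unfolding R
    proof (rule sum_mono)
      fix t assume "t \<in> {a..b}"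
      then have "t \<in> {1..T}" using sub by blast
      then show "f t (x t) - f t (u t) \<le> g t \<bullet> (x t - u t)"
        using g assms(10) by (auto simp: subdifferential_on_def)
    qed
    also have "\<dots> \<le> ((?D\<^sup>2 / 2 + ?D * V) / (?D * sqrt c) + ?D * sqrt c)
        * sqrt (\<Sum>t\<in>{a..b}. (norm (g t))\<^sup>2)"
      unfolding V_def
      using sub D c upd
      by (intro run_regret_bound[OF \<open>convex C\<close> \<open>closed C\<close> diam _ ab x assms(10)]) auto
    also have "\<dots> \<le> (2 * ?D * sqrt c) * sqrt (\<Sum>t\<in>{a..b}. (norm (g t))\<^sup>2)"
      by (intro mult_right_mono coeff) (simp add: sum_nonneg)
    finally show ?thesis
      by (simp add: Q_def R c_def mult.assoc)
  qed
  have PT: "P T \<ge> 0"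
    using assms(7,8) by simp
  obtain K :: nat where K: "K \<ge> 1" "?vb (int K - 1) < P T" "P T \<le> ?vb (int K)"
    and least: "(LEAST j. P T \<le> ?vb j) = int K"
    using ex_budget_index[OF D PT] by metis
  have cover: "{1..T} = (\<Union>k\<in>{1..K}. R k)"
  proof
    show "(\<Union>k\<in>{1..K}. R k) \<subseteq> {1..T}"
      by (auto simp: R_def)
    show "{1..T} \<subseteq> (\<Union>k\<in>{1..K}. R k)"
    proof
      fix t assume t: "t \<in> {1..T}"
      then have "P t \<ge> 0" using assms(7) by simp
      then obtain k :: nat where k: "k \<ge> 1" "?vb (int k - 1) < P t" "P t \<le> ?vb (int k)"
        using ex_budget_index[OF D] by metis
      have "?vb (int k - 1) < ?vb (int K)"
        using k(2) mono[of t T] t K(3) by simp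
      then have "k \<le> K"
        using variation_budget_mono[OF D, of "int K" "int k - 1"] by linarith
      then show "t \<in> (\<Union>k\<in>{1..K}. R k)"
        using t k by (auto simp: R_def)
    qed
  qed
  have disj: "R i \<inter> R j = {}" if "i < j" for i j
    using variation_budget_mono[OF D, of "int i" "int j - 1"] that by (auto simp: R_def)
  have split: "(\<Sum>t\<in>{1..T}. h t) = (\<Sum>k\<in>{1..K}. \<Sum>t\<in>R k. h t)" for h :: "nat \<Rightarrow> real"
    unfolding cover
  proof (rule sum.UNION_disjoint)
    show "\<forall>i\<in>{1..K}. \<forall>j\<in>{1..K}. i \<noteq> j \<longrightarrow> R i \<inter> R j = {}"
      using disj by (metis Int_commute nat_neq_iff)
  qed (auto simp: R_def)
  let ?c = "\<lambda>k::nat. 2 ^ (k - 1) - 1 / 2 :: real"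
  have c0: "?c k \<ge> 0" for k
  proof -
    have "(1::real) \<le> 2 ^ (k - 1)" by simp
    then show ?thesis by linarith
  qed
  have Q0: "Q k \<ge> 0" for k
    by (simp add: Q_def sum_nonneg)
  have budget: "(\<Sum>k\<in>{1..K}. ?c k) \<le> 4 * (P T / ?D + (6 - real K) / 8)"
  proof -
    \<comment> \<open>Minimality of \<open>K\<close>; the exponent is -1 when \<open>K = 1\<close>.
      The sum of constants is then below \<open>4 * P T / ?D + 3 - K / 2\<close>, whence the
      correction \<open>(6 - K) / 8\<close>.\<close>
    have "(2::real) powi (int K - 2) < P T / ?D + 1"
      using K(2) D by (simp add: variation_budget_def field_simps)
    moreover have "(2::real) powi (int K - 2) = 2 ^ K / 4"
      by (simp add: power_int_diff)
    ultimately show ?thesis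
      unfolding sum_run_constants by argo
  qed
  have "(\<Sum>t\<in>{1..T}. f t (x t) - f t (u t)) \<le> (\<Sum>k\<in>{1..K}. 2 * ?D * (sqrt (?c k) * sqrt (Q k)))"
    unfolding split using run by (intro sum_mono) auto
  \<comment> \<open>The absolute values only prepare the form of Cauchy-Schwarz in
    \<open>L2_set_mult_ineq\<close>.\<close>
  also have "\<dots> = 2 * ?D * (\<Sum>k\<in>{1..K}. \<bar>sqrt (?c k)\<bar> * \<bar>sqrt (Q k)\<bar>)"
    using c0 Q0 by (simp add: sum_distrib_left)
  also have "\<dots> \<le> 2 * ?D * (sqrt (\<Sum>k\<in>{1..K}. ?c k) * sqrt (\<Sum>k\<in>{1..K}. Q k))"
    using D L2_set_mult_ineq[of "\<lambda>k. sqrt (?c k)" "\<lambda>k. sqrt (Q k)" "{1..K}"] c0 Q0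
    by (intro mult_left_mono) (simp_all add: L2_set_def)
  also have "\<dots> \<le> 2 * ?D * (sqrt (4 * (P T / ?D + (6 - real K) / 8)) * sqrt (\<Sum>k\<in>{1..K}. Q k))"
    using D Q0 budget by (intro mult_left_mono mult_right_mono) (auto simp: sum_nonneg)
  also have "sqrt (4 * (P T / ?D + (6 - real K) / 8)) = 2 * sqrt (P T / ?D + (6 - real K) / 8)"
    unfolding real_sqrt_mult by simp
  also have "2 * ?D * (\<dots> * sqrt (\<Sum>k\<in>{1..K}. Q k)) = regret_bound ?D (P T) (sqrt (\<Sum>t\<in>{1..T}. (norm (g t))\<^sup>2))"
    unfolding regret_bound_def least split Q_def[symmetric] Let_def by simp
  finally show ?thesis
    using regret_bound_le_minimax by blast
qed

end
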